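(* Let $\Sigma=(\Sigma_0,\Sigma_1,\Sigma_2)$ be a generalised 2-polygraph which is terminating (with underlying transitive Noetherian relation $>$ on $\Sigma_0$), closed under congruence, and which cancels inverses. If $\Sigma$ has a Winkler-Buchberger structure $\mathsf{WB}$ (with respect to $>$), then $\Sigma$ has a homotopy basis.
   Context: A 1-polygraph consists of two sets $\Sigma_0$ (objects), $\Sigma_1$ (reduction steps) and functions $s_0,t_0:\Sigma_1\to\Sigma_0$ (source, target). $(x\leadsto y)$ is the set of steps with source $x$ and target $y$. $(x\leadsto^* y)$ is the set of finite, possibly empty, composable sequences of steps from $x$ to $y$. $(x\leftrightsquigarrow^* y)$ is the set of (reduction) zig-zags from $x$ to $y$: an object sequence $x=x_0,x_1,\dots,x_n=y$ together with $u_1,\dots,u_n$ where each $u_i$ is either a step in $(x_{i-1}\leadsto x_i)$ or a formally inverted step in $(x_i\leadsto x_{i-1})$. The set of all zig-zags is $(\Sigma_1\uplus\Sigma_1^{-1})^*$; $s_0,t_0$ extend to zig-zags as first and last object. Concatenation is written $u\cdot v$, reversal (inverting every step) $u^{-1}$, and the empty zig-zag at $x$ is $\varepsilon_x$. A generalised 2-polygraph is a 1-polygraph together with a set $\Sigma_2$ and functions $s_1,t_1:\Sigma_2\to(\Sigma_1\uplus\Sigma_1^{-1})^*$ with $s_0(s_1(\alpha))=s_0(t_1(\alpha))$ and $t_0(s_1(\alpha))=t_0(t_1(\alpha))$ for all $\alpha\in\Sigma_2$. An $\alpha\in\Sigma_2$ with $s_1(\alpha)=u$, $t_1(\alpha)=v$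 is a rewrite step from $u$ to $v$. Rewrite zig-zags $(u\Leftrightarrow^* v)$ are the zig-zags (possibly empty finite composable sequences of rewrite steps and formally inverted rewrite steps) from $u$ to $v$; the set of all of them is $(\Sigma_2\uplus\Sigma_2^{-1})^*$, and $s_1,t_1$ extend to them as first and last reduction zig-zag. A relation $>$ on a set $M$ is Noetherian if every element is accessible, where accessibility is defined inductively: $n$ is accessible if all $m$ with $n>m$ are accessible. - Terminating: $\Sigma$ is equipped with a transitive Noetherian relation $>$ on $\Sigma_0$ such that $x>y$ whenever there is a step in $(x\leadsto y)$. - Closed under congruence: for any $\alpha\in(\Sigma_2\uplus\Sigma_2^{-1})^*$ and zig-zags $u,v$ with $t_0(u)=s_0(s_1(\alpha))$ and $s_0(v)=t_0(t_1(\alpha))$, there is a chosen rewrite zig-zag $u\cdot\alpha\cdot v\in(\Sigma_2\uplus\Sigma_2^{-1})^*$ with $s_1(u\cdot\alpha\cdot v)=u\cdot s_1(\alpha)\cdot v$ and $t_1(u\cdot\alpha\cdot v)=u\cdot t_1(\alpha)\cdot v$. - Cancels inverses: for every step $s\in(x\leadsto y)$ there are given rewrite zig-zags $\mathsf{RINV}(s)\in(s\cdot s^{-1}\Leftrightarrow^*\varepsilon_x)$ and $\mathsf{LINV}(s)\in(s^{-1}\cdot s\Leftrightarrow^*\varepsilon_y)$. - Local peak: a zig-zag $u=s^{-1}\cdot t$ from $y$ to $z$ with $s\in(x\leadsto y)$, $t\in(x\leadsto z)$. - Winkler-Buchberger structure: for each local peak $u$ from $y$ to $z$ with peak object $x$,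 a rewrite zig-zag $\mathsf{WB}(u)$ with $s_1(\mathsf{WB}(u))=u$ such that every object $x_i$ strictly between the first and last entries ($y$ and $z$) of the object sequence of $t_1(\mathsf{WB}(u))$ satisfies $x>x_i$. - Homotopy basis: for all $x,y\in\Sigma_0$ and all $u,v\in(x\leftrightsquigarrow^* y)$, a rewrite zig-zag $\alpha_{u,v}\in(u\Leftrightarrow^* v)$. *)

theory Defs
  imports Main
begin

section \<open>1-polygraphs and zig-zags\<close>

record ('x, 's) polygraph =
  objs :: "'x set"
  steps :: "'s set"
  src :: "'s \<Rightarrow> 'x"
  tgt :: "'s \<Rightarrow> 'x"

definition one_polygraph :: "('x, 's, 'm) polygraph_scheme \<Rightarrow> bool" where
  "one_polygraph P \<longleftrightarrow> (\<forall>s\<in>steps P. src P s \<in> objs P \<and> tgt P s \<in> objs P)"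

datatype 's signed = Fwd 's | Bwd 's

primrec ssrc :: "('x, 's, 'm) polygraph_scheme \<Rightarrow> 's signed \<Rightarrow> 'x" where
  "ssrc P (Fwd s) = src P s"
| "ssrc P (Bwd s) = tgt P s"

primrec stgt :: "('x, 's, 'm) polygraph_scheme \<Rightarrow> 's signed \<Rightarrow> 'x" where
  "stgt P (Fwd s) = tgt P s"
| "stgt P (Bwd s) = src P s"

primrec sflip :: "'s signed \<Rightarrow> 's signed" where
  "sflip (Fwd s) = Bwd s"
| "sflip (Bwd s) = Fwd s"

definition signed_steps :: "('x, 's, 'm) polygraph_scheme \<Rightarrow> 's signed set" where
  "signed_steps P = Fwd ` steps P \<union> Bwd ` steps P"

text \<open>
  A zig-zag is stored as its first object together with its list of signed steps; the first object
  is needed to tell apart the empty zig-zags. The remaining objects of the object sequence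
  are the targets of the signed steps.
\<close>

type_synonym ('x, 's) zigzag = "'x \<times> 's signed list"

primrec chain :: "('x, 's, 'm) polygraph_scheme \<Rightarrow> 'x \<Rightarrow> 's signed list \<Rightarrow> bool" where
  "chain P x [] \<longleftrightarrow> x \<in> objs P"
| "chain P x (u # us) \<longleftrightarrow> x \<in> objs P \<and> u \<in> signed_steps P \<and> ssrc P u = x \<and> chain P (stgt P u) us"

definition zigzags :: "('x, 's, 'm) polygraph_scheme \<Rightarrow> ('x, 's) zigzag set" where
  "zigzags P = {z. chain P (fst z) (snd z)}"

definition obj_seq :: "('x, 's, 'm) polygraph_scheme \<Rightarrow> ('x, 's) zigzag \<Rightarrow> 'x list" where
  "obj_seq P z = fst z # map (stgt P) (snd z)"

definition zsrc :: "('x, 's, 'm) polygraph_scheme \<Rightarrow> ('x, 's) zigzag \<Rightarrow> 'x" where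
  "zsrc P z = hd (obj_seq P z)"

definition ztgt :: "('x, 's, 'm) polygraph_scheme \<Rightarrow> ('x, 's) zigzag \<Rightarrow> 'x" where
  "ztgt P z = last (obj_seq P z)"

definition zigzags_between ::
    "('x, 's, 'm) polygraph_scheme \<Rightarrow> 'x \<Rightarrow> 'x \<Rightarrow> ('x, 's) zigzag set" where
  "zigzags_between P x y = {z \<in> zigzags P. zsrc P z = x \<and> ztgt P z = y}"

definition zempty :: "'x \<Rightarrow> ('x, 's) zigzag" where
  "zempty x = (x, [])"

definition zstep :: "('x, 's, 'm) polygraph_scheme \<Rightarrow> 's \<Rightarrow> ('x, 's) zigzag" where
  "zstep P s = (src P s, [Fwd s])"

text \<open>Concatenation is meaningful only if the target of \<open>u\<close> is the source of \<open>v\<close>.\<close>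

definition zconc :: "('x, 's) zigzag \<Rightarrow> ('x, 's) zigzag \<Rightarrow> ('x, 's) zigzag"  (infixr "\<cdot>" 70) where
  "u \<cdot> v = (fst u, snd u @ snd v)"

definition zrev :: "('x, 's, 'm) polygraph_scheme \<Rightarrow> ('x, 's) zigzag \<Rightarrow> ('x, 's) zigzag" where
  "zrev P z = (ztgt P z, rev (map sflip (snd z)))"


section \<open>Generalised 2-polygraphs\<close>

record ('x, 's, 'a) polygraph2 = "('x, 's) polygraph" +
  rules :: "'a set"
  rsrc :: "'a \<Rightarrow> ('x, 's) zigzag"
  rtgt :: "'a \<Rightarrow> ('x, 's) zigzag"

definition generalised_2_polygraph :: "('x, 's, 'a) polygraph2 \<Rightarrow> bool" where
  "generalised_2_polygraph P \<longleftrightarrow> one_polygraph P \<and>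
     (\<forall>a\<in>rules P. rsrc P a \<in> zigzags P \<and> rtgt P a \<in> zigzags P \<and>
        zsrc P (rsrc P a) = zsrc P (rtgt P a) \<and> ztgt P (rsrc P a) = ztgt P (rtgt P a))"

text \<open>
  The rewrite steps form a 1-polygraph whose objects are the reduction zig-zags; rewrite zig-zags
  are the zig-zags of this polygraph.
\<close>

definition rew :: "('x, 's, 'a) polygraph2 \<Rightarrow> (('x, 's) zigzag, 'a) polygraph" where
  "rew P = \<lparr>objs = zigzags P, steps = rules P, src = rsrc P, tgt = rtgt P\<rparr>"

text \<open>
  Accessibility is the library's accessible part: \<open>accp r n\<close> holds if \<open>accp r m\<close> for all
  \<open>m\<close> with \<open>r m n\<close>.
\<close>

definition noetherian_on :: "'x set \<Rightarrow> ('x \<Rightarrow> 'x \<Rightarrow> bool) \<Rightarrow> bool" where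
  "noetherian_on M gt \<longleftrightarrow> (\<forall>n\<in>M. Wellfounded.accp (\<lambda>m n. m \<in> M \<and> n \<in> M \<and> gt n m) n)"

definition terminating :: "('x, 's, 'm) polygraph_scheme \<Rightarrow> ('x \<Rightarrow> 'x \<Rightarrow> bool) \<Rightarrow> bool" where
  "terminating P gt \<longleftrightarrow> transp_on (objs P) gt \<and> noetherian_on (objs P) gt \<and>
     (\<forall>s\<in>steps P. gt (src P s) (tgt P s))"

definition congruence_closed ::
    "('x, 's, 'a) polygraph2 \<Rightarrow>
     (('x, 's) zigzag \<Rightarrow> (('x, 's) zigzag, 'a) zigzag \<Rightarrow> ('x, 's) zigzag \<Rightarrow> (('x, 's) zigzag, 'a) zigzag) \<Rightarrow>
     bool" where
  "congruence_closed P cong \<longleftrightarrow>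
     (\<forall>\<alpha>\<in>zigzags (rew P). \<forall>u\<in>zigzags P. \<forall>v\<in>zigzags P.
        ztgt P u = zsrc P (zsrc (rew P) \<alpha>) \<longrightarrow> zsrc P v = ztgt P (ztgt (rew P) \<alpha>) \<longrightarrow>
        cong u \<alpha> v \<in>
          zigzags_between (rew P) (u \<cdot> zsrc (rew P) \<alpha> \<cdot> v) (u \<cdot> ztgt (rew P) \<alpha> \<cdot> v))"

definition cancels_inverses ::
    "('x, 's, 'a) polygraph2 \<Rightarrow> ('s \<Rightarrow> (('x, 's) zigzag, 'a) zigzag) \<Rightarrow>
     ('s \<Rightarrow> (('x, 's) zigzag, 'a) zigzag) \<Rightarrow> bool" where
  "cancels_inverses P RINV LINV \<longleftrightarrow>
     (\<forall>s\<in>steps P.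
        RINV s \<in> zigzags_between (rew P) (zstep P s \<cdot> zrev P (zstep P s)) (zempty (src P s)) \<and>
        LINV s \<in> zigzags_between (rew P) (zrev P (zstep P s) \<cdot> zstep P s) (zempty (tgt P s)))"

definition local_peak :: "('x, 's, 'm) polygraph_scheme \<Rightarrow> 'x \<Rightarrow> ('x, 's) zigzag \<Rightarrow> bool" where
  "local_peak P x u \<longleftrightarrow>
     (\<exists>s\<in>steps P. \<exists>t\<in>steps P. src P s = x \<and> src P t = x \<and> u = zrev P (zstep P s) \<cdot> zstep P t)"

definition winkler_buchberger ::
    "('x, 's, 'a) polygraph2 \<Rightarrow> ('x \<Rightarrow> 'x \<Rightarrow> bool) \<Rightarrow>
     (('x, 's) zigzag \<Rightarrow> (('x, 's) zigzag, 'a) zigzag) \<Rightarrow> bool" where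
  "winkler_buchberger P gt WB \<longleftrightarrow>
     (\<forall>x u. local_peak P x u \<longrightarrow>
        WB u \<in> zigzags (rew P) \<and> zsrc (rew P) (WB u) = u \<and>
        (let xs = obj_seq P (ztgt (rew P) (WB u))
         in \<forall>i. 0 < i \<and> i < length xs - 1 \<longrightarrow> gt x (xs ! i)))"

definition homotopy_basis ::
    "('x, 's, 'a) polygraph2 \<Rightarrow>
     (('x, 's) zigzag \<Rightarrow> ('x, 's) zigzag \<Rightarrow> (('x, 's) zigzag, 'a) zigzag) \<Rightarrow> bool" where
  "homotopy_basis P B \<longleftrightarrow>
     (\<forall>x\<in>objs P. \<forall>y\<in>objs P. \<forall>u\<in>zigzags_between P x y. \<forall>v\<in>zigzags_between P x y.
        B u v \<in> zigzags_between (rew P) u v)"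

end

theory Submission
  imports Defs "HOL-Library.Multiset"
begin

text \<open>
  Every closed zig-zag is rewritten to the empty one, by induction on the multiset of the objects
  it visits cyclically. By termination, a nonempty closed zig-zag contains, up to cyclic rotation,
  a local peak; replacing it along the Winkler-Buchberger structure trades the peak object for
  smaller ones and so decreases the multiset. Rotations are conjugations, hence harmless since
  inverses cancel. For parallel \<open>u\<close>, \<open>v\<close> one then has \<open>u \<Leftrightarrow>\<^sup>* u \<cdot> v\<^sup>-\<^sup>1 \<cdot> v \<Leftrightarrow>\<^sup>* v\<close>.
\<close>

section \<open>Paths\<close>

text \<open>Both endpoints are arguments, so splitting a concatenation exposes the intermediate
  object. Being generic in the polygraph, the predicate serves for reduction and rewrite zig-zags
  alike.\<close>

primrec path :: "('x, 's, 'm) polygraph_scheme \<Rightarrow> 'x \<Rightarrow> 's signed list \<Rightarrow> 'x \<Rightarrow> bool" where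
  "path P x [] y \<longleftrightarrow> x \<in> objs P \<and> x = y"
| "path P x (u # us) y \<longleftrightarrow>
     x \<in> objs P \<and> u \<in> signed_steps P \<and> ssrc P u = x \<and> path P (stgt P u) us y"

lemma path_iff_chain:
  "path P x us y \<longleftrightarrow> chain P x us \<and> last (x # map (stgt P) us) = y"
  by (induction us arbitrary: x) auto

lemma zigzags_between_iff_path:
  "z \<in> zigzags_between P x y \<longleftrightarrow> fst z = x \<and> path P x (snd z) y"
  unfolding zigzags_between_def zigzags_def path_iff_chain zsrc_def ztgt_def obj_seq_def by auto

lemma path_src: "path P x us y \<Longrightarrow> x \<in> objs P"
  by (cases us) auto

lemma path_tgt: "path P x us y \<Longrightarrow> y \<in> objs P"
  by (induction us arbitrary: x) auto

lemma path_append: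
  "path P x (us @ vs) z \<longleftrightarrow> (\<exists>y. path P x us y \<and> path P y vs z)"
proof (induction us arbitrary: x)
  case Nil
  show ?case using path_src by fastforce
qed auto

lemma signed_steps_simps [simp]:
  "Fwd s \<in> signed_steps P \<longleftrightarrow> s \<in> steps P"
  "Bwd s \<in> signed_steps P \<longleftrightarrow> s \<in> steps P"
  by (auto simp: signed_steps_def)

lemma sflip_simps [simp]:
  "ssrc P (sflip u) = stgt P u"
  "stgt P (sflip u) = ssrc P u"
  "sflip (sflip u) = u"
  "sflip u \<in> signed_steps P \<longleftrightarrow> u \<in> signed_steps P"
  by (cases u; simp)+

lemma sflip_comp_sflip [simp]: "sflip \<circ> sflip = id"
  by auto

lemma path_rev:
  "path P x us y \<Longrightarrow> path P y (rev (map sflip us)) x"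
proof (induction us arbitrary: x)
  case (Cons u us)
  then show ?case using path_src[of P "stgt P u" us y] by (auto simp: path_append)
qed simp

section \<open>Object sequences and cyclic rotation\<close>

lemma path_map_ssrc:
  "path P x us y \<Longrightarrow> map (ssrc P) us = butlast (x # map (stgt P) us)"
  by (induction us arbitrary: x) auto

lemma path_ssrc_objs: "path P x us y \<Longrightarrow> u \<in> set us \<Longrightarrow> ssrc P u \<in> objs P"
  by (induction us arbitrary: x) auto

text \<open>Bridges from interior indices of the object sequence, as used by the Winkler-Buchberger
  condition, to step sources. Sources form the object sequence without its last entry, so dropping
  the first step leaves interior positions.\<close>

lemma mem_tl_obj_seq:
  assumes "path P x (u # us) y" "v \<in> set us"
  obtains i where "0 < i" "i < length (obj_seq P (x, u # us)) - 1"
    "ssrc P v = obj_seq P (x, u # us) ! i"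
proof -
  obtain j where j: "j < length us" "v = us ! j"
    using assms(2) by (auto simp: in_set_conv_nth)
  have "ssrc P v = map (ssrc P) (u # us) ! Suc j" using j by simp
  also have "\<dots> = obj_seq P (x, u # us) ! Suc j"
    using path_map_ssrc[OF assms(1)] j by (simp add: obj_seq_def nth_butlast del: butlast.simps)
  finally show thesis using that[of "Suc j"] j by (simp add: obj_seq_def)
qed

lemma ex_rotate_peak:
  assumes "Fwd a \<in> set w" "Bwd b \<in> set w"
  obtains us vs s t r where "w = us @ vs" "vs @ us = Bwd s # Fwd t # r"
proof -
  obtain p q where w: "w = p @ Bwd b # q" using assms(2) by (meson split_list)
  \<comment> \<open>A first rotation puts a backward step in front, so the first forward step of
    \<open>w'\<close> has a predecessor, and that predecessor is backward.\<close>
  define w' where "w' = Bwd b # q @ p"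
  have w': "w' = rotate (length p) w" unfolding w w'_def by (simp add: rotate_append)
  have "\<exists>u\<in>set w'. u \<in> range Fwd" using assms(1) by (auto simp: w')
  then obtain bs f r where split: "w' = bs @ f # r" "f \<in> range Fwd" "\<forall>u\<in>set bs. u \<notin> range Fwd"
    using split_list_first_prop[of w' "\<lambda>u. u \<in> range Fwd"] by blast
  then obtain t where t: "f = Fwd t" by blast
  have "bs \<noteq> []" using split(1) t by (auto simp: w'_def)
  then obtain cs c where bs: "bs = cs @ [c]" by (cases bs rule: rev_cases) auto
  obtain s where c: "c = Bwd s" using split(3) bs by (cases c) auto
  \<comment> \<open>A second rotation brings this adjacent pair to the front.\<close>
  have "rotate (length cs) w' = Bwd s # Fwd t # r @ cs"
    unfolding split(1) bs c t by (simp add: rotate_append)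
  then have "rotate (length cs + length p) w = Bwd s # Fwd t # r @ cs"
    by (simp add: w' rotate_rotate)
  then show thesis
    using that[of "take ((length cs + length p) mod length w) w"
        "drop ((length cs + length p) mod length w) w"]
    by (simp add: rotate_drop_take)
qed


section \<open>Rewriting zig-zags\<close>

locale wb_polygraph =
  fixes P :: "('x, 's, 'a) polygraph2"
    and gt :: "'x \<Rightarrow> 'x \<Rightarrow> bool"
    and cong RINV LINV WB
  assumes generalised: "generalised_2_polygraph P"
    and termin: "terminating P gt"
    and congr: "congruence_closed P cong"
    and cancel: "cancels_inverses P RINV LINV"
    and wb: "winkler_buchberger P gt WB"
begin

text \<open>Only existence is recorded; specific rewrite zig-zags are chosen at the very end. A
  single start object suffices because rewriting preserves it.\<close>

definition hom :: "'x \<Rightarrow> 's signed list \<Rightarrow> 's signed list \<Rightarrow> bool" where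
  "hom x us vs \<longleftrightarrow> (\<exists>\<alpha>. path (rew P) (x, us) \<alpha> (x, vs))"

lemma objs_rew [simp]: "z \<in> objs (rew P) \<longleftrightarrow> (\<exists>y. path P (fst z) (snd z) y)"
  by (auto simp: rew_def zigzags_def path_iff_chain)

lemma hom_refl: "path P x us y \<Longrightarrow> hom x us us"
  unfolding hom_def by (rule exI[of _ "[]"]) auto

lemma hom_sym: "hom x us vs \<Longrightarrow> hom x vs us"
  unfolding hom_def using path_rev[of "rew P"] by blast

lemma hom_trans [trans]: "hom x us vs \<Longrightarrow> hom x vs ws \<Longrightarrow> hom x us ws"
  unfolding hom_def using path_append[of "rew P"] by blast

lemma ztgt_eq: "path P x us y \<Longrightarrow> ztgt P (x, us) = y"
  by (simp add: path_iff_chain ztgt_def obj_seq_def)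

text \<open>Rules, and hence inverted rules, relate parallel zig-zags; induction carries this along
  \<open>\<alpha>\<close>.\<close>

lemma path_rew_endpoints:
  "path (rew P) z \<alpha> z' \<Longrightarrow> fst z' = fst z \<and> ztgt P z' = ztgt P z"
proof (induction \<alpha> arbitrary: z)
  case (Cons a \<alpha>)
  have "zsrc P (ssrc (rew P) a) = zsrc P (stgt (rew P) a) \<and>
      ztgt P (ssrc (rew P) a) = ztgt P (stgt (rew P) a)"
    using Cons.prems generalised
    by (cases a) (auto simp: generalised_2_polygraph_def rew_def)
  then show ?case using Cons by (auto simp: zsrc_def obj_seq_def)
qed auto

lemma hom_path:
  assumes "hom x us vs" "path P x us y"
  shows "path P x vs y"
proof -
  obtain \<alpha> where \<alpha>: "path (rew P) (x, us) \<alpha> (x, vs)" using assms(1) hom_def by blast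
  \<comment> \<open>Objects of \<open>rew P\<close> are zig-zags of \<open>P\<close>, so
    \<open>vs\<close> is composable from \<open>x\<close> to some \<open>z\<close>; preservation of
    targets then forces \<open>z\<close> to be \<open>y\<close>.\<close>
  obtain z where "path P x vs z" using path_tgt[OF \<alpha>] by auto
  then show ?thesis using path_rew_endpoints[OF \<alpha>] assms(2) ztgt_eq by metis
qed

lemma hom_cong:
  assumes us: "path P x us y" and vs: "path P y vs z" and ws: "path P z ws t"
    and "hom y vs vs'"
  shows "hom x (us @ vs @ ws) (us @ vs' @ ws)"
proof -
  obtain \<alpha> where \<alpha>: "path (rew P) (y, vs) \<alpha> (y, vs')" using assms(4) hom_def by blast
  have vs': "path P y vs' z" using hom_path assms by blast
  have "((y, vs), \<alpha>) \<in> zigzags_between (rew P) (y, vs) (y, vs')"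
    using \<alpha> by (simp add: zigzags_between_iff_path)
  then have z: "((y, vs), \<alpha>) \<in> zigzags (rew P)" "zsrc (rew P) ((y, vs), \<alpha>) = (y, vs)"
    "ztgt (rew P) ((y, vs), \<alpha>) = (y, vs')"
    by (auto simp: zigzags_between_def)
  have "(x, us) \<in> zigzags P" "(z, ws) \<in> zigzags P"
    using us ws by (auto simp: zigzags_def path_iff_chain)
  moreover have "ztgt P (x, us) = zsrc P (y, vs)" "zsrc P (z, ws) = ztgt P (y, vs')"
    using ztgt_eq[OF us] ztgt_eq[OF vs'] by (auto simp: zsrc_def obj_seq_def)
  ultimately have "cong (x, us) ((y, vs), \<alpha>) (z, ws) \<in>
      zigzags_between (rew P) (x, us @ vs @ ws) (x, us @ vs' @ ws)"
    using congr z unfolding congruence_closed_def zconc_def by (metis fst_conv snd_conv)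
  then show ?thesis unfolding hom_def zigzags_between_iff_path by auto
qed

section \<open>Cancellation of inverses and conjugation\<close>

lemma hom_cancel_step:
  assumes "u \<in> signed_steps P"
  shows "hom (ssrc P u) [u, sflip u] []"
proof -
  obtain s where s: "s \<in> steps P" "u = Fwd s \<or> u = Bwd s"
    using assms by (auto simp: signed_steps_def)
  have "RINV s \<in> zigzags_between (rew P) (src P s, [Fwd s, Bwd s]) (src P s, [])"
    "LINV s \<in> zigzags_between (rew P) (tgt P s, [Bwd s, Fwd s]) (tgt P s, [])"
    using cancel s(1)
    by (auto simp: cancels_inverses_def zstep_def zrev_def zconc_def zempty_def ztgt_def obj_seq_def)
  then show ?thesis using s(2) by (auto simp: hom_def zigzags_between_iff_path)
qed

text \<open>Cancellation works from the inside out: congruence removes \<open>us\<close> and its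
  reversal between \<open>u\<close> and \<open>sflip u\<close>, and the remaining adjacent pair
  cancels by \<open>RINV\<close> or \<open>LINV\<close>.\<close>

lemma hom_cancel_right:
  "path P x us y \<Longrightarrow> hom x (us @ rev (map sflip us)) []"
proof (induction us arbitrary: x)
  case Nil
  then show ?case by (auto intro: hom_refl)
next
  case (Cons u us)
  then have u: "u \<in> signed_steps P" "x = ssrc P u" "x \<in> objs P" by auto
  have us: "path P (stgt P u) us y" using Cons.prems by simp
  have step: "path P x [u] (stgt P u)" using Cons.prems us path_src by fastforce
  have "hom x ([u] @ (us @ rev (map sflip us)) @ [sflip u]) ([u] @ [] @ [sflip u])"
  proof (rule hom_cong[OF step])
    show "path P (stgt P u) (us @ rev (map sflip us)) (stgt P u)"
      using us path_rev[OF us] by (auto simp: path_append)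
    show "path P (stgt P u) [sflip u] x" using path_rev[OF step] u(3) by simp
  qed (rule Cons.IH[OF us])
  also have "hom x ([u] @ [] @ [sflip u]) []" using hom_cancel_step u by simp
  finally show ?case by simp
qed

lemma hom_cancel_left:
  assumes "path P x us y"
  shows "hom y (rev (map sflip us) @ us) []"
  using hom_cancel_right[OF path_rev[OF assms]] by (simp add: rev_map)

text \<open>Conjugation by \<open>us\<close>: appending \<open>us\<close> and its reversal to
  \<open>us @ vs\<close> exposes the loop \<open>vs @ us\<close> in the middle. Contracting it
  leaves \<open>us\<close> followed by its reversal, which cancels.\<close>

lemma hom_rotate:
  assumes us: "path P x us y" and vs: "path P y vs x" and null: "hom y (vs @ us) []"
  shows "hom x (us @ vs) []"
proof -
  let ?us' = "rev (map sflip us)"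
  have us': "path P y ?us' x" using path_rev[OF us] .
  have uv: "path P x (us @ vs) x" using us vs by (auto simp: path_append)
  have vu: "path P y (vs @ us) y" using us vs by (auto simp: path_append)
  have x: "path P x [] x" using path_src[OF us] by simp
  have "hom x ((us @ vs) @ [] @ []) ((us @ vs) @ (us @ ?us') @ [])"
    by (rule hom_cong[OF uv x x hom_sym[OF hom_cancel_right[OF us]]])
  also have "hom x ((us @ vs) @ (us @ ?us') @ []) (us @ [] @ ?us')"
    using hom_cong[OF us vu us' null] by simp
  also have "hom x (us @ [] @ ?us') []" using hom_cancel_right[OF us] by simp
  finally show ?thesis by simp
qed

section \<open>Consequences of termination\<close>

lemma transD: "\<lbrakk>gt x y; gt y z; x \<in> objs P; y \<in> objs P; z \<in> objs P\<rbrakk> \<Longrightarrow> gt x z"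
  using termin by (auto simp: terminating_def dest: transp_onD)

text \<open>The converse of \<open>gt\<close>, restricted to objects: the smaller element comes
  first, as \<open>wf\<close> and \<open>mult\<close> expect.\<close>

definition less_rel :: "('x \<times> 'x) set" where
  "less_rel = {(m, n). m \<in> objs P \<and> n \<in> objs P \<and> gt n m}"

lemma wf_less_rel: "wf less_rel"
proof -
  let ?r = "\<lambda>m n. m \<in> objs P \<and> n \<in> objs P \<and> gt n m"
  \<comment> \<open>Elements outside \<open>objs P\<close> have no predecessors under
    \<open>?r\<close> and are vacuously accessible, so accessibility holds on the whole
    type.\<close>
  have "Wellfounded.accp ?r n" for n
    using termin by (cases "n \<in> objs P") (auto simp: terminating_def noetherian_on_def intro: accpI)
  then have "wfp ?r" by (simp add: accp_wfpI)
  then show ?thesis by (simp add: less_rel_def wfp_def)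
qed

lemma gt_irrefl: "x \<in> objs P \<Longrightarrow> \<not> gt x x"
  using wf_not_sym[OF wf_less_rel, of x x] by (auto simp: less_rel_def)

lemma forward_path_gt:
  "path P x us y \<Longrightarrow> us \<noteq> [] \<Longrightarrow> \<forall>u\<in>set us. u \<in> range Fwd \<Longrightarrow> gt x y"
proof (induction us arbitrary: x)
  case (Cons u us)
  then obtain s where s: "u = Fwd s" "s \<in> steps P" "src P s = x" by auto
  have us: "path P (tgt P s) us y" using Cons.prems s by simp
  have st: "gt x (tgt P s)" using s termin by (auto simp: terminating_def)
  show ?case
  proof (cases "us = []")
    case True
    then show ?thesis using st us by simp
  next
    case False
    have "x \<in> objs P" using Cons.prems(1) by simp
    then show ?thesis
      using Cons.IH[of "tgt P s"] us False Cons.prems(3) st transD path_src[OF us] path_tgt[OF us]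
      by auto
  qed
qed simp

text \<open>A nonempty loop of forward steps alone would give \<open>gt x x\<close>, contradicting
  well-foundedness; a loop of backward steps alone becomes a forward one when reversed.\<close>

lemma loop_has_both_directions:
  assumes "path P x w x" "w \<noteq> []"
  obtains a b where "Fwd a \<in> set w" "Bwd b \<in> set w"
proof -
  have irrefl: "\<not> gt x x" using gt_irrefl path_src[OF assms(1)] by blast
  have *: "u \<in> range Fwd \<longleftrightarrow> (\<forall>b. u \<noteq> Bwd b)" for u :: "'s signed" by (cases u) auto
  have "\<exists>b. Bwd b \<in> set w"
    using forward_path_gt[OF assms] irrefl * by blast
  moreover have "\<exists>a. Fwd a \<in> set w"
  proof (rule ccontr)
    assume neg: "\<nexists>a. Fwd a \<in> set w"
    have "sflip u \<in> range Fwd" if "u \<in> set w" for u using neg that by (cases u) auto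
    then show False using forward_path_gt[OF path_rev[OF assms(1)]] assms(2) irrefl by auto
  qed
  ultimately show thesis using that by blast
qed

section \<open>Resolving peaks and contracting loops\<close>

text \<open>The bound concerns \<open>tl vs\<close> because the first step of a resolution starts at
  the endpoint \<open>tgt P s\<close>, which the Winkler-Buchberger condition leaves out; the later
  steps start at interior objects.\<close>

lemma peak_resolution:
  assumes s: "s \<in> steps P" and t: "t \<in> steps P" and eq: "src P s = src P t"
  obtains vs where "hom (tgt P s) [Bwd s, Fwd t] vs"
    "\<And>v. v \<in> set (tl vs) \<Longrightarrow> (ssrc P v, src P s) \<in> less_rel"
proof -
  let ?x = "src P s" and ?y = "tgt P s" and ?u = "(tgt P s, [Bwd s, Fwd t])"
  have "?u = zrev P (zstep P s) \<cdot> zstep P t"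
    by (simp add: zrev_def zstep_def zconc_def ztgt_def obj_seq_def)
  then have "local_peak P ?x ?u" unfolding local_peak_def using assms by metis
  then have W: "WB ?u \<in> zigzags (rew P)" "zsrc (rew P) (WB ?u) = ?u"
    and small: "\<And>i. 0 < i \<Longrightarrow> i < length (obj_seq P (ztgt (rew P) (WB ?u))) - 1 \<Longrightarrow>
      gt ?x (obj_seq P (ztgt (rew P) (WB ?u)) ! i)"
    using wb unfolding winkler_buchberger_def Let_def by blast+
  obtain y' vs where v: "ztgt (rew P) (WB ?u) = (y', vs)" by fastforce
  have pth: "path (rew P) ?u (snd (WB ?u)) (y', vs)"
    using W v zigzags_between_iff_path[of "WB ?u" "rew P" ?u "(y', vs)"]
    by (auto simp: zigzags_between_def)
  have y': "y' = ?y" using path_rew_endpoints[OF pth] by simp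
  have hom: "hom ?y [Bwd s, Fwd t] vs" using pth y' hom_def by auto
  have objs: "?x \<in> objs P" "?y \<in> objs P" "tgt P t \<in> objs P"
    using generalised s t by (auto simp: generalised_2_polygraph_def one_polygraph_def)
  have "path P ?y [Bwd s, Fwd t] (tgt P t)" using s t eq objs by auto
  then have vs: "path P ?y vs (tgt P t)" using hom_path hom by blast
  have "(ssrc P u, ?x) \<in> less_rel" if u: "u \<in> set (tl vs)" for u
  proof -
    obtain v' vs' where vs': "vs = v' # vs'" using u by (cases vs) auto
    obtain i where "0 < i" "i < length (obj_seq P (?y, vs)) - 1" "ssrc P u = obj_seq P (?y, vs) ! i"
      using mem_tl_obj_seq[OF vs[unfolded vs'], of u] u vs' by auto
    then have "gt ?x (ssrc P u)" using small[of i] by (simp add: v y')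
    moreover have "ssrc P u \<in> objs P" using path_ssrc_objs[OF vs] u vs' by auto
    ultimately show ?thesis using objs by (simp add: less_rel_def)
  qed
  then show thesis using that hom by blast
qed

text \<open>The step sources of a loop are its object sequence without the repeated last entry.
  Their multiset is thus invariant under rotation, which lets the induction use
  \<open>mult less_rel\<close>.\<close>

lemma loop_null:
  "path P x w x \<Longrightarrow> hom x w []"
proof (induction "mset (map (ssrc P) w)" arbitrary: w x rule: wf_induct_rule[OF wf_mult[OF wf_less_rel]])
  case (1 w x)
  show ?case
  proof (cases "w = []")
    case True
    then show ?thesis using 1 hom_refl by blast
  next
    case False
    obtain a b where "Fwd a \<in> set w" "Bwd b \<in> set w"
      using loop_has_both_directions[OF 1(2) False] .
    then obtain us vs s t r where w: "w = us @ vs" and rot: "vs @ us = Bwd s # Fwd t # r"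
      by (rule ex_rotate_peak)
    obtain y where us: "path P x us y" and vs: "path P y vs x" using 1(2) w path_append by metis
    have "path P y (Bwd s # Fwd t # r) y" using us vs path_append rot by metis
    then have s: "s \<in> steps P" and t: "t \<in> steps P" and st: "src P s = src P t"
      and y: "y = tgt P s" and objs: "y \<in> objs P" "src P s \<in> objs P"
      and r: "path P (tgt P t) r y"
      by auto
    have peak: "path P y [Bwd s, Fwd t] (tgt P t)" using s t st y objs path_src[OF r] by auto
    obtain ps where ps: "hom y [Bwd s, Fwd t] ps"
      and small: "\<And>v. v \<in> set (tl ps) \<Longrightarrow> (ssrc P v, src P s) \<in> less_rel"
      using peak_resolution[OF s t st] y by blast
    have ps': "path P y ps (tgt P t)" using hom_path[OF ps peak] .
    \<comment> \<open>The rotated loop has the same multiset, and its first two steps start at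
      \<open>y\<close> and at the peak object.\<close>
    have mw: "mset (map (ssrc P) w) = {#y, src P s#} + mset (map (ssrc P) r)"
    proof -
      have "mset w = mset (vs @ us)" by (simp add: w)
      then have "mset (map (ssrc P) w) = mset (map (ssrc P) (vs @ us))" by (simp only: mset_map)
      then show ?thesis by (simp add: rot y st)
    qed
    have "(mset (map (ssrc P) (ps @ r)), mset (map (ssrc P) w)) \<in> mult less_rel"
    proof (cases ps)
      case Nil
      \<comment> \<open>An empty resolution just deletes both entries.\<close>
      have "(mset (map (ssrc P) r) + {#}, mset (map (ssrc P) r) + {#y, src P s#}) \<in> mult less_rel"
        by (rule one_step_implies_mult) auto
      then show ?thesis unfolding mw by (simp add: Nil)
    next
      case (Cons p ps0)
      \<comment> \<open>A nonempty resolution again starts at \<open>y\<close>, so that entry stays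
        in the common part and only the peak object is traded for the smaller sources in
        \<open>ps0\<close>.\<close>
      have "(add_mset y (mset (map (ssrc P) r)) + mset (map (ssrc P) ps0),
          add_mset y (mset (map (ssrc P) r)) + {#src P s#}) \<in> mult less_rel"
        using small by (intro one_step_implies_mult) (auto simp: Cons)
      moreover have "ssrc P p = y" using ps' Cons by simp
      ultimately show ?thesis unfolding mw by (simp add: Cons add_mset_commute union_commute)
    qed
    then have null: "hom y (ps @ r) []" using 1(1) ps' r path_append by metis
    have "hom y ([] @ [Bwd s, Fwd t] @ r) ([] @ ps @ r)"
      using objs by (intro hom_cong[OF _ peak r ps]) simp
    then have "hom y (vs @ us) []" using null hom_trans rot by simp
    then show ?thesis using hom_rotate[OF us vs] w by simp
  qed
qed

lemma parallel_hom:
  assumes us: "path P x us y" and vs: "path P x vs y"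
  shows "hom x us vs"
proof -
  let ?vs' = "rev (map sflip vs)"
  have vs': "path P y ?vs' x" using path_rev[OF vs] .
  have objs: "path P x [] x" "path P y [] y" using path_src[OF us] path_tgt[OF us] by auto
  have "hom x (us @ [] @ []) (us @ (?vs' @ vs) @ [])"
    using hom_cong[OF us objs(2) objs(2) hom_sym[OF hom_cancel_left[OF vs]]] .
  also have "hom x (us @ (?vs' @ vs) @ []) ([] @ [] @ vs)"
  proof -
    have loop: "path P x (us @ ?vs') x" using us vs' by (auto simp: path_append)
    show ?thesis using hom_cong[OF objs(1) loop vs loop_null[OF loop]] by simp
  qed
  finally show ?thesis by simp
qed

end

theorem theorem14:
  fixes P :: "('x, 's, 'a) polygraph2"
    and gt :: "'x \<Rightarrow> 'x \<Rightarrow> bool"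
    and cong :: "('x, 's) zigzag \<Rightarrow> (('x, 's) zigzag, 'a) zigzag \<Rightarrow> ('x, 's) zigzag \<Rightarrow>
      (('x, 's) zigzag, 'a) zigzag"
    and RINV LINV :: "'s \<Rightarrow> (('x, 's) zigzag, 'a) zigzag"
    and WB :: "('x, 's) zigzag \<Rightarrow> (('x, 's) zigzag, 'a) zigzag"
  assumes "generalised_2_polygraph P"
    and "terminating P gt"
    and "congruence_closed P cong"
    and "cancels_inverses P RINV LINV"
    and "winkler_buchberger P gt WB"
  shows "\<exists>B. homotopy_basis P B"
proof -
  interpret wb_polygraph P gt cong RINV LINV WB
    using assms by unfold_locales
  have "\<exists>\<beta>. \<beta> \<in> zigzags_between (rew P) u v"
    if "u \<in> zigzags_between P x y" "v \<in> zigzags_between P x y" for x y u v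
  proof -
    have "hom x (snd u) (snd v)" "fst u = x" "fst v = x"
      using that parallel_hom by (auto simp: zigzags_between_iff_path)
    then obtain \<beta> where "path (rew P) u \<beta> v" by (metis hom_def prod.collapse)
    \<comment> \<open>A rewrite zig-zag is stored with its first object, which is here the zig-zag
      \<open>u\<close> itself.\<close>
    then have "(u, \<beta>) \<in> zigzags_between (rew P) u v" by (simp add: zigzags_between_iff_path)
    then show ?thesis ..
  qed
  \<comment> \<open>Choice selects one rewrite zig-zag for each parallel pair; the endpoints
    \<open>x\<close> and \<open>y\<close> are already determined by \<open>u\<close>.\<close>
  then have "homotopy_basis P (\<lambda>u v. SOME \<beta>. \<beta> \<in> zigzags_between (rew P) u v)"
    unfolding homotopy_basis_def by (meson someI_ex)
  then show ?thesis by blast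
qed

end
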